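(* Let $\rho:[0,+\infty)\to\mathbb{R}$ satisfy: (AS1) $\rho(0)=0$, $\rho(s)<+\infty$ for all $s<+\infty$, and $0$ is the strict minimizer of $\rho$; (AS2) $\rho$ is increasing on $[0,+\infty)$; (AS3) $\rho$ is $C^2$ on $(0,+\infty)$; (AS4) either $\rho''<0$ and $\rho''$ is strictly increasing on $(0,+\infty)$, or $\rho''\equiv0$ on $(0,+\infty)$. Let $0<\tau<+\infty$ and $\mathcal{T}(s)=\rho(\min(s,\tau))$ for $s\ge0$. Let $V=\mathbb{R}^{N\times N}$, $Q=\mathbb{R}^{N\times N}\times\mathbb{R}^{N\times N}$, let $\mathbf{A}:V\to V$ be linear with $\mathbf{A}^{\mathsf T}\mathbf{A}$ invertible (AS5), $\mathbf{f}\in V$, $\alpha>0$, $\beta>0$, and consider the constrained problem $$\min_{(\mathbf{u},\mathbf{q})\in V\times Q}\ R(\mathbf{q})+\frac{\alpha}{2}\|\mathbf{A}\mathbf{u}-\mathbf{f}\|_V^2\quad\text{s.t. }\mathbf{q}=\nabla\mathbf{u},\qquad R(\mathbf{q})=\sum_{1\le i,j\le N}\mathcal{T}(|\mathbf{q}_{ij}|),\qquad(\mathrm{P})$$ with augmented Lagrangian $$\mathcal{L}(\mathbf{u},\mathbf{q};\boldsymbol{\lambda})=R(\mathbf{q})+\frac{\alpha}{2}\|\mathbf{A}\mathbf{u}-\mathbf{f}\|_V^2+(\boldsymbol{\lambda},\mathbf{q}-\nabla\mathbf{u})_Q+\frac{\beta}{2}\|\mathbf{q}-\nabla\mathbf{u}\|_Q^2.$$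 Let $\{(\mathbf{u}^k,\mathbf{q}^k,\boldsymbol{\lambda}^k)\}_{k\ge0}$ be a sequence generated by ADMM: from arbitrary $(\mathbf{u}^0,\mathbf{q}^0,\boldsymbol{\lambda}^0)\in V\times Q\times Q$, for $k=0,1,2,\dots$, $$\mathbf{q}^{k+1}\in\arg\min_{\mathbf{q}\in Q}\mathcal{L}(\mathbf{u}^k,\mathbf{q};\boldsymbol{\lambda}^k),\qquad \mathbf{u}^{k+1}=\arg\min_{\mathbf{u}\in V}\mathcal{L}(\mathbf{u},\mathbf{q}^{k+1};\boldsymbol{\lambda}^k),\qquad \boldsymbol{\lambda}^{k+1}=\boldsymbol{\lambda}^k+\beta(\mathbf{q}^{k+1}-\nabla\mathbf{u}^{k+1}).$$ Assume that $\boldsymbol{\lambda}^{k+1}-\boldsymbol{\lambda}^k\to0$ as $k\to\infty$. Then any cluster point of the sequence $\{(\mathbf{u}^k,\mathbf{q}^k,\boldsymbol{\lambda}^k)\}$, if one exists, is a KKT point of problem $(\mathrm{P})$.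
   Context: "Increasing" in (AS2) is meant in the non-strict sense. $V$ and $Q$ carry the standard Euclidean inner products $(\cdot,\cdot)_V$, $(\cdot,\cdot)_Q$ and norms. For $\mathbf{q}=(q^{(1)},q^{(2)})\in Q$, $\mathbf{q}_{ij}=(q^{(1)}_{ij},q^{(2)}_{ij})$ and $|\mathbf{q}_{ij}|=\sqrt{(q^{(1)}_{ij})^2+(q^{(2)}_{ij})^2}$. $\nabla\mathbf{u}=(\nabla_x\mathbf{u},\nabla_y\mathbf{u})$, where $\nabla_x,\nabla_y$ are the forward difference operators in the two coordinate directions with periodic boundary condition. The superscript $\mathsf T$ denotes the adjoint. The $\arg\min$'s are sets of (or the unique) global minimizers. A KKT point of $(\mathrm{P})$ is a triple $(\mathbf{u}^*,\mathbf{q}^*,\boldsymbol{\lambda}^* )\in V\times Q\times Q$ with $$-\boldsymbol{\lambda}^*\in\partial R(\mathbf{q}^* ),\qquad \alpha\mathbf{A}^{\mathsf T}(\mathbf{A}\mathbf{u}^*-\mathbf{f})-\nabla^{\mathsf T}\boldsymbol{\lambda}^*=0,\qquad \mathbf{q}^*=\nabla\mathbf{u}^*.$$ Here $\partial$ is the limiting sub-differential: for $h:\mathbb{R}^d\to(-\infty,+\infty]$ proper and $h(z)<+\infty$, $\partial h(z)$ is the set of all $z_*\in\mathbb{R}^d$ for which there exist sequences $z^k\to z$, $z_*^k\to z_*$ with $h(z^k)\to h(z)$ and $$\liminf_{v\to z^k,\,v\neq z^k}\frac{h(v)-h(z^k)-\langle z_*^k,v-z^k\rangle}{\|v-z^k\|}\ge0\quad\text{for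 all }k.$$ *)

theory Defs
  imports "HOL-Analysis.Analysis"
begin

text \<open>The index set \<open>{1,\<dots>,N}\<close> is a finite linearly ordered type \<open>'n\<close> with
  \<open>CARD('n) = N\<close>. The library norms and inner products on \<open>real ^ 'n ^ 'n\<close> (entry \<open>u\<^sub>i\<^sub>j\<close> is
  \<open>u $ i $ j\<close>) and on pairs of such matrices are the Euclidean ones.\<close>

type_synonym 'n img = "real ^ 'n ^ 'n"
type_synonym 'n img2 = "'n img \<times> 'n img"

definition cyc_succ :: "'n::{finite,linorder} \<Rightarrow> 'n" where
  "cyc_succ i = (if i = Max UNIV then Min UNIV else Min {j. i < j})"

text \<open>Convention: the \<open>x\<close>-direction is along the second index, the \<open>y\<close>-direction along the first.\<close>

definition grad_x :: "'n::{finite,linorder} img \<Rightarrow> 'n img" where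
  "grad_x u = (\<chi> i j. u $ i $ cyc_succ j - u $ i $ j)"

definition grad_y :: "'n::{finite,linorder} img \<Rightarrow> 'n img" where
  "grad_y u = (\<chi> i j. u $ cyc_succ i $ j - u $ i $ j)"

definition grad :: "'n::{finite,linorder} img \<Rightarrow> 'n img2" where
  "grad u = (grad_x u, grad_y u)"

definition pt_norm :: "'n::finite img2 \<Rightarrow> 'n \<Rightarrow> 'n \<Rightarrow> real" where
  "pt_norm q i j = sqrt ((fst q $ i $ j)\<^sup>2 + (snd q $ i $ j)\<^sup>2)"

definition C2_on :: "real set \<Rightarrow> (real \<Rightarrow> real) \<Rightarrow> bool" where
  "C2_on S g \<longleftrightarrow>
     (\<forall>s\<in>S. g field_differentiable (at s)) \<and>
     (\<forall>s\<in>S. deriv g field_differentiable (at s)) \<and>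
     continuous_on S (deriv (deriv g))"

definition trunc :: "(real \<Rightarrow> real) \<Rightarrow> real \<Rightarrow> real \<Rightarrow> real" where
  "trunc \<rho> \<tau> s = \<rho> (min s \<tau>)"

definition regularizer :: "(real \<Rightarrow> real) \<Rightarrow> real \<Rightarrow> 'n::finite img2 \<Rightarrow> real" where
  "regularizer \<rho> \<tau> q = (\<Sum>i\<in>UNIV. \<Sum>j\<in>UNIV. trunc \<rho> \<tau> (pt_norm q i j))"

definition objective ::
  "(real \<Rightarrow> real) \<Rightarrow> real \<Rightarrow> real \<Rightarrow> ('n::finite img \<Rightarrow> 'n img) \<Rightarrow> 'n img
    \<Rightarrow> 'n img \<Rightarrow> 'n img2 \<Rightarrow> real" where
  "objective \<rho> \<tau> \<alpha> A f u q = regularizer \<rho> \<tau> q + \<alpha> / 2 * (norm (A u - f))\<^sup>2"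

definition aug_lagrangian ::
  "(real \<Rightarrow> real) \<Rightarrow> real \<Rightarrow> real \<Rightarrow> real \<Rightarrow> ('n::{finite,linorder} img \<Rightarrow> 'n img) \<Rightarrow> 'n img
    \<Rightarrow> 'n img \<Rightarrow> 'n img2 \<Rightarrow> 'n img2 \<Rightarrow> real" where
  "aug_lagrangian \<rho> \<tau> \<alpha> \<beta> A f u q l =
     objective \<rho> \<tau> \<alpha> A f u q + inner l (q - grad u) + \<beta> / 2 * (norm (q - grad u))\<^sup>2"

definition admm_sequence ::
  "(real \<Rightarrow> real) \<Rightarrow> real \<Rightarrow> real \<Rightarrow> real \<Rightarrow> ('n::{finite,linorder} img \<Rightarrow> 'n img) \<Rightarrow> 'n img
    \<Rightarrow> (nat \<Rightarrow> 'n img) \<Rightarrow> (nat \<Rightarrow> 'n img2) \<Rightarrow> (nat \<Rightarrow> 'n img2) \<Rightarrow> bool" where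
  "admm_sequence \<rho> \<tau> \<alpha> \<beta> A f u q l \<longleftrightarrow>
     (\<forall>k. is_arg_min (\<lambda>q'. aug_lagrangian \<rho> \<tau> \<alpha> \<beta> A f (u k) q' (l k)) (\<lambda>_. True) (q (Suc k)) \<and>
          is_arg_min (\<lambda>u'. aug_lagrangian \<rho> \<tau> \<alpha> \<beta> A f u' (q (Suc k)) (l k)) (\<lambda>_. True) (u (Suc k)) \<and>
          l (Suc k) = l k + \<beta> *\<^sub>R (q (Suc k) - grad (u (Suc k))))"

text \<open>Limiting subdifferential of a proper \<open>h\<close>. The clauses \<open>h z < \<infinity>\<close> and \<open>h (zs k) < \<infinity>\<close> make the difference
  quotients meaningful; without them \<open>\<infinity> - \<infinity> = \<infinity>\<close> in \<^typ>\<open>ereal\<close> would satisfy the liminf condition.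
  The filter \<open>at (zs k)\<close> already excludes \<open>v = zs k\<close>.\<close>

definition limiting_subdiff :: "('a::euclidean_space \<Rightarrow> ereal) \<Rightarrow> 'a \<Rightarrow> 'a set" where
  "limiting_subdiff h z =
     {w. h z < \<infinity> \<and>
         (\<exists>zs ws. zs \<longlonglongrightarrow> z \<and> ws \<longlonglongrightarrow> w \<and> (\<lambda>k. h (zs k)) \<longlonglongrightarrow> h z \<and>
            (\<forall>k. h (zs k) < \<infinity> \<and>
                 Liminf (at (zs k))
                   (\<lambda>v. (h v - h (zs k) - ereal (inner (ws k) (v - zs k))) / ereal (norm (v - zs k)))
                 \<ge> 0))}"

definition KKT_point ::
  "(real \<Rightarrow> real) \<Rightarrow> real \<Rightarrow> real \<Rightarrow> ('n::{finite,linorder} img \<Rightarrow> 'n img) \<Rightarrow> 'n img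
    \<Rightarrow> 'n img \<times> 'n img2 \<times> 'n img2 \<Rightarrow> bool" where
  "KKT_point \<rho> \<tau> \<alpha> A f = (\<lambda>(u, q, l).
     - l \<in> limiting_subdiff (\<lambda>q'. ereal (regularizer \<rho> \<tau> q')) q \<and>
     \<alpha> *\<^sub>R adjoint A (A u - f) - adjoint grad l = 0 \<and>
     q = grad u)"

definition cluster_point :: "(nat \<Rightarrow> 'a::metric_space) \<Rightarrow> 'a \<Rightarrow> bool" where
  "cluster_point X p \<longleftrightarrow> (\<exists>r. strict_mono r \<and> (X \<circ> r) \<longlonglongrightarrow> p)"

end

theory Submission
  imports Defs
begin

text \<open>The first-order condition of the \<open>u\<close>-step reads
  \<open>\<alpha> A\<^sup>T (A u\<^sup>k\<^sup>+\<^sup>1 - f) = \<nabla>\<^sup>T \<lambda>\<^sup>k\<^sup>+\<^sup>1\<close>, so \<open>\<lambda>\<^sup>k\<^sup>+\<^sup>1 - \<lambda>\<^sup>k \<rightarrow> 0\<close> and invertibility of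
  \<open>A\<^sup>T A\<close> give \<open>u\<^sup>k\<^sup>+\<^sup>1 - u\<^sup>k \<rightarrow> 0\<close>. The \<open>q\<close>-step makes
  \<open>- \<lambda>\<^sup>k\<^sup>+\<^sup>1 - \<beta> \<nabla> (u\<^sup>k\<^sup>+\<^sup>1 - u\<^sup>k)\<close> a regular subgradient of \<open>R\<close> at \<open>q\<^sup>k\<^sup>+\<^sup>1\<close>, and this tends to
  \<open>- \<lambda>\<^sup>*\<close> along the subsequence. As \<open>\<rho>\<close> may jump at \<open>0\<close>, the convergence \<open>R(q\<^sup>k\<^sup>+\<^sup>1) \<rightarrow> R(q\<^sup>*)\<close>
  is obtained by squeezing: lower semicontinuity bounds \<open>R(q\<^sup>k\<^sup>+\<^sup>1)\<close> from below, and comparing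
  \<open>q\<^sup>k\<^sup>+\<^sup>1\<close> with \<open>q\<^sup>*\<close> in the \<open>q\<close>-step bounds it from above.\<close>

section \<open>First-order conditions for the two minimization steps\<close>

lemma linear_coeff_eq_0_if_quadratic_nonneg:
  fixes c d :: real
  assumes "\<And>t. 0 \<le> c * t + d * t\<^sup>2"
  shows "c = 0"
proof -
  have "((\<lambda>t. c * t + d * t\<^sup>2) has_real_derivative c) (at 0)"
    by (auto intro!: derivative_eq_intros)
  then show ?thesis
    by (rule DERIV_local_min[where d = 1]) (use assms in auto)
qed

lemma norm_add_sq:
  fixes x y :: "'a::real_inner"
  shows "(norm (x + y))\<^sup>2 = (norm x)\<^sup>2 + 2 * inner x y + (norm y)\<^sup>2"
  by (simp add: power2_norm_eq_inner inner_add_left inner_add_right inner_commute)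

text \<open>Perturbing \<open>x\<close> along the residual \<open>w\<close> of the claimed equation
  changes the objective by a quadratic in the step \<open>t\<close> whose linear coefficient is
  \<open>inner w w\<close>. In the application, \<open>l + \<beta> *\<^sub>R (q - G x)\<close> is
  the updated multiplier.\<close>

lemma penalized_least_squares_optimality:
  fixes A :: "'a::euclidean_space \<Rightarrow> 'b::euclidean_space" and G :: "'a \<Rightarrow> 'c::euclidean_space"
  assumes A: "linear A" and G: "linear G"
    and min: "\<And>v. \<alpha> / 2 * (norm (A x - f))\<^sup>2 + inner l (q - G x) + \<beta> / 2 * (norm (q - G x))\<^sup>2
       \<le> \<alpha> / 2 * (norm (A v - f))\<^sup>2 + inner l (q - G v) + \<beta> / 2 * (norm (q - G v))\<^sup>2"
  shows "\<alpha> *\<^sub>R adjoint A (A x - f) = adjoint G (l + \<beta> *\<^sub>R (q - G x))"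
proof -
  define w where "w = \<alpha> *\<^sub>R adjoint A (A x - f) - adjoint G (l + \<beta> *\<^sub>R (q - G x))"
  have "inner w w = 0"
  proof (rule linear_coeff_eq_0_if_quadratic_nonneg)
    fix t :: real
    have Aw: "A (x + t *\<^sub>R w) - f = (A x - f) + t *\<^sub>R A w"
      and Gw: "q - G (x + t *\<^sub>R w) = (q - G x) + (- t) *\<^sub>R G w"
      using A G by (simp_all add: linear_add linear_scale)
    \<comment> \<open>Only the second argument is unfolded; the first stays \<open>w\<close>, so
      that the adjoints can be moved onto it.\<close>
    have ww: "inner w w = \<alpha> * inner (A x - f) (A w) - inner (l + \<beta> *\<^sub>R (q - G x)) (G w)"
      by (subst (2) w_def)
        (simp add: inner_diff_right adjoint_works[OF A] adjoint_works[OF G] inner_commute)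
    show "0 \<le> inner w w * t
        + (\<alpha> / 2 * (norm (A w))\<^sup>2 + \<beta> / 2 * (norm (G w))\<^sup>2) * t\<^sup>2"
      using min[of "x + t *\<^sub>R w"] unfolding Aw Gw norm_add_sq ww
      by (simp add: inner_add_right inner_add_left algebra_simps power_mult_distrib)
  qed
  then show ?thesis by (simp add: w_def)
qed

text \<open>Expanding the penalty about \<open>z\<close> leaves, besides the linear term, only
  \<open>\<beta> / 2 * (norm (v - z))\<^sup>2\<close>, which vanishes as \<open>v\<close> tends to
  \<open>z\<close> even after division by \<open>norm (v - z)\<close>. Neither convexity nor
  continuity of \<open>h\<close> enters.\<close>

lemma regular_subgradient_of_proximal_min:
  fixes h :: "'a::euclidean_space \<Rightarrow> real"
  assumes min: "\<And>v. h z + inner l (z - g) + \<beta> / 2 * (norm (z - g))\<^sup>2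
                 \<le> h v + inner l (v - g) + \<beta> / 2 * (norm (v - g))\<^sup>2"
  shows "0 \<le> Liminf (at z) (\<lambda>v.
    (ereal (h v) - ereal (h z) - ereal (inner (- l - \<beta> *\<^sub>R (z - g)) (v - z))) / ereal (norm (v - z)))"
proof -
  have "((\<lambda>v. ereal (- (\<beta> / 2) * norm (v - z))) \<longlongrightarrow> ereal (- (\<beta> / 2) * norm (z - z))) (at z)"
    by (intro tendsto_intros)
  then have "0 = Liminf (at z) (\<lambda>v. ereal (- (\<beta> / 2) * norm (v - z)))"
    by (intro lim_imp_Liminf[symmetric]) (simp_all add: zero_ereal_def)
  also have "\<dots> \<le> Liminf (at z) (\<lambda>v.
    (ereal (h v) - ereal (h z) - ereal (inner (- l - \<beta> *\<^sub>R (z - g)) (v - z))) / ereal (norm (v - z)))"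
  proof (rule Liminf_mono, rule eventually_mono[OF eventually_neq_at_within[of z]])
    fix v assume "v \<noteq> z"
    then have pos: "0 < norm (v - z)" by simp
    have v: "v - g = (z - g) + (v - z)" by simp
    have "- (\<beta> / 2) * (norm (v - z))\<^sup>2 \<le> h v - h z - inner (- l - \<beta> *\<^sub>R (z - g)) (v - z)"
      using min[of v] unfolding v norm_add_sq
      by (simp add: inner_add_right inner_diff_left algebra_simps)
    then have "- (\<beta> / 2) * norm (v - z)
        \<le> (h v - h z - inner (- l - \<beta> *\<^sub>R (z - g)) (v - z)) / norm (v - z)"
      using pos by (simp add: le_divide_eq power2_eq_square mult.assoc)
    then show "ereal (- (\<beta> / 2) * norm (v - z)) \<le>
      (ereal (h v) - ereal (h z) - ereal (inner (- l - \<beta> *\<^sub>R (z - g)) (v - z))) / ereal (norm (v - z))"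
      using pos by simp
  qed
  finally show ?thesis .
qed

section \<open>The discrete gradient and limits of the regularizer\<close>

lemma linear_grad: "linear grad"
  by (intro linearI)
    (simp_all add: grad_def grad_x_def grad_y_def vec_eq_iff algebra_simps)

lemma tendsto_pt_norm:
  assumes "(q \<longlongrightarrow> z) F"
  shows "((\<lambda>k. pt_norm (q k) i j) \<longlongrightarrow> pt_norm z i j) F"
  unfolding pt_norm_def by (intro tendsto_intros assms)

lemma pt_norm_nonneg: "0 \<le> pt_norm q i j"
  by (simp add: pt_norm_def)

lemma tendsto_trunc:
  assumes C2: "C2_on {0<..} \<rho>" and tau: "0 < \<tau>" and s: "0 < s" and x: "(x \<longlongrightarrow> s) F"
  shows "((\<lambda>k. trunc \<rho> \<tau> (x k)) \<longlongrightarrow> trunc \<rho> \<tau> s) F"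
proof -
  have "isCont \<rho> (min s \<tau>)"
    using C2 s tau by (auto simp: C2_on_def intro: field_differentiable_imp_continuous_at)
  then show ?thesis
    unfolding trunc_def by (rule isCont_tendsto_compose) (intro tendsto_intros x)
qed

text \<open>Continuity can fail only at entries where \<open>z\<close> vanishes, and there the
  truncated potential is bounded below by its value 0 at the origin. This gives the lower half of
  the squeeze; \<open>g\<close> supplies the upper half.\<close>

lemma regularizer_squeeze:
  fixes q :: "'b \<Rightarrow> 'n::finite img2"
  assumes AS1: "\<rho> 0 = 0" "\<forall>s>0. \<rho> 0 < \<rho> s" and C2: "C2_on {0<..} \<rho>" and tau: "0 < \<tau>"
    and q: "(q \<longlongrightarrow> z) F"
    and upper: "\<And>k. regularizer \<rho> \<tau> (q k) \<le> g k" and g: "(g \<longlongrightarrow> regularizer \<rho> \<tau> z) F"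
  shows "((\<lambda>k. regularizer \<rho> \<tau> (q k)) \<longlongrightarrow> regularizer \<rho> \<tau> z) F"
proof -
  have trunc0: "trunc \<rho> \<tau> 0 = 0"
    using AS1 tau by (simp add: trunc_def)
  have trunc_nonneg: "0 \<le> trunc \<rho> \<tau> s" if "0 \<le> s" for s
  proof (cases "s = 0")
    case False
    then have "0 < min s \<tau>" using that tau by simp
    then show ?thesis using AS1 unfolding trunc_def by (metis less_imp_le)
  qed (simp add: trunc0)
  \<comment> \<open>A minorant of each summand that is continuous along \<open>q\<close>: the
    entries where \<open>\<rho>\<close> may jump are replaced by their limit value 0.\<close>
  define b where "b v i j = (if pt_norm z i j = 0 then 0 else trunc \<rho> \<tau> (pt_norm v i j))"
    for v :: "'n img2" and i j
  have b_le: "b v i j \<le> trunc \<rho> \<tau> (pt_norm v i j)" for v i j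
    by (simp add: b_def trunc_nonneg pt_norm_nonneg)
  have "((\<lambda>k. b (q k) i j) \<longlongrightarrow> trunc \<rho> \<tau> (pt_norm z i j)) F" for i j
  proof (cases "pt_norm z i j = 0")
    case False
    then have "0 < pt_norm z i j" using pt_norm_nonneg[of z i j] by simp
    from tendsto_trunc[OF C2 tau this tendsto_pt_norm[OF q]] show ?thesis
      using False by (simp add: b_def)
  qed (simp add: b_def trunc0)
  then have lim: "((\<lambda>k. \<Sum>i\<in>UNIV. \<Sum>j\<in>UNIV. b (q k) i j) \<longlongrightarrow> regularizer \<rho> \<tau> z) F"
    unfolding regularizer_def by (intro tendsto_sum)
  show ?thesis
    by (rule tendsto_sandwich[OF _ _ lim g])
      (auto simp: regularizer_def intro!: always_eventually sum_mono b_le upper[unfolded regularizer_def])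
qed

section \<open>Passage to the limit along a subsequence of the iterates\<close>

theorem theorem7p7:
  fixes \<rho> :: "real \<Rightarrow> real" and \<tau> \<alpha> \<beta> :: real
    and A :: "'n::{finite,linorder} img \<Rightarrow> 'n img"
    and f :: "'n img"
    and u :: "nat \<Rightarrow> 'n img"
    and q l :: "nat \<Rightarrow> 'n img2"
    and p :: "'n img \<times> 'n img2 \<times> 'n img2"
  assumes AS1: "\<rho> 0 = 0" "\<forall>s>0. \<rho> 0 < \<rho> s"
    and AS2: "mono_on {0..} \<rho>"
    and AS3: "C2_on {0<..} \<rho>"
    and AS4: "((\<forall>s>0. deriv (deriv \<rho>) s < 0) \<and> strict_mono_on {0<..} (deriv (deriv \<rho>))) \<or>
              (\<forall>s>0. deriv (deriv \<rho>) s = 0)"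
    and tau: "0 < \<tau>"
    and A_linear: "linear A"
    and AS5: "bij (adjoint A \<circ> A)"
    and alpha: "0 < \<alpha>" and beta: "0 < \<beta>"
    and admm: "admm_sequence \<rho> \<tau> \<alpha> \<beta> A f u q l"
    and multiplier: "(\<lambda>k. l (Suc k) - l k) \<longlonglongrightarrow> 0"
    and cluster: "cluster_point (\<lambda>k. (u k, q k, l k)) p"
  shows "KKT_point \<rho> \<tau> \<alpha> A f p"
proof -
  obtain us qs ls where p: "p = (us, qs, ls)" by (cases p)
  obtain r where r: "strict_mono r" and lim: "((\<lambda>k. (u k, q k, l k)) \<circ> r) \<longlonglongrightarrow> p"
    using cluster by (auto simp: cluster_point_def)
  \<comment> \<open>Starting at \<open>r (Suc k)\<close>, which is at least 1, makes every selected
    triple the output of an ADMM step; \<open>m k\<close> is the index of the input of that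
    step.\<close>
  define m where "m k = r (Suc k) - 1" for k
  have Suc_m: "Suc (m k) = r (Suc k)" for k
    using strict_mono_imp_increasing[OF r, of "Suc k"] by (simp add: m_def)
  have "strict_mono m"
    unfolding strict_mono_Suc_iff
  proof
    fix k
    have "Suc (m k) < Suc (m (Suc k))"
      unfolding Suc_m using r by (simp add: strict_monoD)
    then show "m k < m (Suc k)" by simp
  qed
  then have m_top: "filterlim m at_top sequentially"
    by (rule filterlim_subseq)
  have "(\<lambda>k. (u (Suc (m k)), q (Suc (m k)), l (Suc (m k)))) \<longlonglongrightarrow> (us, qs, ls)"
    using LIMSEQ_Suc[OF lim] by (simp add: o_def Suc_m p)
  from tendsto_fst[OF this] tendsto_fst[OF tendsto_snd[OF this]] tendsto_snd[OF tendsto_snd[OF this]]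
  have u_Suc: "(\<lambda>k. u (Suc (m k))) \<longlonglongrightarrow> us" and q_Suc: "(\<lambda>k. q (Suc (m k))) \<longlonglongrightarrow> qs"
    and l_Suc: "(\<lambda>k. l (Suc (m k))) \<longlonglongrightarrow> ls"
    by simp_all
  have adjG: "linear (adjoint grad :: 'n img2 \<Rightarrow> 'n img)"
    by (rule adjoint_linear[OF linear_grad])
  have adjA: "linear (adjoint A)"
    by (rule adjoint_linear[OF A_linear])
  have lin_lim: "(\<lambda>k. L (x k)) \<longlonglongrightarrow> L y" if "linear L" "x \<longlonglongrightarrow> y"
    for L :: "'c::euclidean_space \<Rightarrow> 'd::euclidean_space" and x y
    using linear_continuous_at[OF linear_conv_bounded_linear[THEN iffD1, OF that(1)]] that(2)
    by (rule isCont_tendsto_compose)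

  have q_min: "regularizer \<rho> \<tau> (q (Suc k)) + inner (l k) (q (Suc k) - grad (u k))
        + \<beta> / 2 * (norm (q (Suc k) - grad (u k)))\<^sup>2
      \<le> regularizer \<rho> \<tau> v + inner (l k) (v - grad (u k)) + \<beta> / 2 * (norm (v - grad (u k)))\<^sup>2"
    for k v
  proof -
    have "aug_lagrangian \<rho> \<tau> \<alpha> \<beta> A f (u k) (q (Suc k)) (l k)
        \<le> aug_lagrangian \<rho> \<tau> \<alpha> \<beta> A f (u k) v (l k)"
      using admm by (simp add: admm_sequence_def is_arg_min_linorder del: split_paired_All)
    then show ?thesis by (simp add: aug_lagrangian_def objective_def)
  qed
  have u_min: "\<alpha> / 2 * (norm (A (u (Suc k)) - f))\<^sup>2 + inner (l k) (q (Suc k) - grad (u (Suc k)))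
        + \<beta> / 2 * (norm (q (Suc k) - grad (u (Suc k))))\<^sup>2
      \<le> \<alpha> / 2 * (norm (A v - f))\<^sup>2 + inner (l k) (q (Suc k) - grad v)
        + \<beta> / 2 * (norm (q (Suc k) - grad v))\<^sup>2" for k v
  proof -
    have "aug_lagrangian \<rho> \<tau> \<alpha> \<beta> A f (u (Suc k)) (q (Suc k)) (l k)
        \<le> aug_lagrangian \<rho> \<tau> \<alpha> \<beta> A f v (q (Suc k)) (l k)"
      using admm by (simp add: admm_sequence_def is_arg_min_linorder)
    then show ?thesis by (simp add: aug_lagrangian_def objective_def)
  qed
  have l_step: "l (Suc k) = l k + \<beta> *\<^sub>R (q (Suc k) - grad (u (Suc k)))" for k
    using admm by (simp add: admm_sequence_def)
  have u_opt: "\<alpha> *\<^sub>R adjoint A (A (u (Suc k)) - f) = adjoint grad (l (Suc k))" for k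
    unfolding l_step
    by (rule penalized_least_squares_optimality[OF A_linear linear_grad u_min])

  have feasible: "qs = grad us"
  proof -
    have "(\<lambda>k. (1 / \<beta>) *\<^sub>R (l (Suc k) - l k)) \<longlonglongrightarrow> (1 / \<beta>) *\<^sub>R 0"
      by (intro tendsto_intros multiplier)
    then have "(\<lambda>k. q (Suc k) - grad (u (Suc k))) \<longlonglongrightarrow> 0"
      using beta by (simp add: l_step)
    from filterlim_compose[OF this m_top] have "(\<lambda>k. q (Suc (m k)) - grad (u (Suc (m k)))) \<longlonglongrightarrow> 0" .
    moreover have "(\<lambda>k. q (Suc (m k)) - grad (u (Suc (m k)))) \<longlonglongrightarrow> qs - grad us"
      by (intro tendsto_intros q_Suc lin_lim[OF linear_grad] u_Suc)
    ultimately have "0 = qs - grad us" by (rule LIMSEQ_unique)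
    then show ?thesis by simp
  qed

  have stationary: "\<alpha> *\<^sub>R adjoint A (A us - f) - adjoint grad ls = 0"
  proof -
    have "(\<lambda>k. \<alpha> *\<^sub>R adjoint A (A (u (Suc (m k))) - f)) \<longlonglongrightarrow> \<alpha> *\<^sub>R adjoint A (A us - f)"
      by (intro tendsto_intros lin_lim[OF adjA] lin_lim[OF A_linear] u_Suc)
    moreover have "(\<lambda>k. adjoint grad (l (Suc (m k)))) \<longlonglongrightarrow> adjoint grad ls"
      by (rule lin_lim[OF adjG l_Suc])
    ultimately have "\<alpha> *\<^sub>R adjoint A (A us - f) = adjoint grad ls"
      unfolding u_opt by (rule LIMSEQ_unique)
    then show ?thesis by simp
  qed

  have u_diff: "(\<lambda>k. u (Suc k) - u k) \<longlonglongrightarrow> 0"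
  proof -
    have lin: "linear (adjoint A \<circ> A)"
      by (rule linear_compose[OF A_linear adjA])
    obtain B where B: "0 < B" "\<And>x. B * norm x \<le> norm ((adjoint A \<circ> A) x)"
      \<comment> \<open>Subtracting two consecutive instances of \<open>u_opt\<close> expresses the
        image of the \<open>u\<close>-increment under \<open>adjoint A \<circ> A\<close> by the
        multiplier increment; \<open>B\<close> turns this into a bound on the
        \<open>u\<close>-increment itself. As \<open>u_opt\<close> says nothing about the initial
        \<open>u 0\<close>, the bound starts one index later.\<close>
      using linear_inj_bounded_below_pos[OF lin bij_is_inj[OF AS5]] by blast
    define e where "e k = norm (adjoint grad (l (Suc (Suc k)) - l (Suc k))) / (\<alpha> * B)" for k
    have le: "norm (u (Suc (Suc k)) - u (Suc k)) \<le> e k" for k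
    proof -
      have "\<alpha> *\<^sub>R (adjoint A \<circ> A) (u (Suc (Suc k)) - u (Suc k))
          = adjoint grad (l (Suc (Suc k)) - l (Suc k))"
        using u_opt[of k] u_opt[of "Suc k"]
        by (simp add: linear_diff[OF A_linear] linear_diff[OF adjA] linear_diff[OF adjG]
            algebra_simps)
      then have "norm (adjoint grad (l (Suc (Suc k)) - l (Suc k)))
          = \<alpha> * norm ((adjoint A \<circ> A) (u (Suc (Suc k)) - u (Suc k)))"
        using alpha by (metis abs_of_pos norm_scaleR)
      with B(2)[of "u (Suc (Suc k)) - u (Suc k)"] show ?thesis
        using alpha B(1) by (simp add: e_def field_simps)
    qed
    have "e \<longlonglongrightarrow> 0"
    proof -
      have "(\<lambda>k. adjoint grad (l (Suc (Suc k)) - l (Suc k))) \<longlonglongrightarrow> adjoint grad 0"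
        by (rule lin_lim[OF adjG LIMSEQ_Suc[OF multiplier]])
      then have "(\<lambda>k. norm (adjoint grad (l (Suc (Suc k)) - l (Suc k)))) \<longlonglongrightarrow> 0"
        unfolding linear_0[OF adjG] by (rule tendsto_norm_zero)
      then show ?thesis
        unfolding e_def by (rule tendsto_divide_zero)
    qed
    then have "(\<lambda>k. u (Suc (Suc k)) - u (Suc k)) \<longlonglongrightarrow> 0"
      by (rule Lim_null_comparison[rotated]) (simp add: le)
    then show ?thesis by (rule LIMSEQ_imp_Suc)
  qed

  \<comment> \<open>The \<open>q\<close>-step involves the old \<open>l\<close> and
    \<open>u\<close>, so their limits are needed as well.\<close>
  have l_m: "(\<lambda>k. l (m k)) \<longlonglongrightarrow> ls"
    using tendsto_diff[OF l_Suc filterlim_compose[OF multiplier m_top]] by simp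
  have u_m: "(\<lambda>k. u (m k)) \<longlonglongrightarrow> us"
    using tendsto_diff[OF u_Suc filterlim_compose[OF u_diff m_top]] by simp

  have "- ls \<in> limiting_subdiff (\<lambda>q'. ereal (regularizer \<rho> \<tau> q')) qs"
  proof -
    define w where "w k = - l (m k) - \<beta> *\<^sub>R (q (Suc (m k)) - grad (u (m k)))" for k
    have "w \<longlonglongrightarrow> - ls - \<beta> *\<^sub>R (qs - grad us)"
      unfolding w_def by (intro tendsto_intros l_m q_Suc lin_lim[OF linear_grad] u_m)
    then have w: "w \<longlonglongrightarrow> - ls" by (simp add: feasible)
    \<comment> \<open>The \<open>q\<close>-step inequality with competitor \<open>qs\<close>, solved
      for the regularizer at the new iterate. The multiplier and penalty terms are continuous and
      cancel in the limit.\<close>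
    define g where "g k = regularizer \<rho> \<tau> qs + inner (l (m k)) (qs - grad (u (m k)))
        + \<beta> / 2 * (norm (qs - grad (u (m k))))\<^sup>2
        - inner (l (m k)) (q (Suc (m k)) - grad (u (m k)))
        - \<beta> / 2 * (norm (q (Suc (m k)) - grad (u (m k))))\<^sup>2" for k
    have "g \<longlonglongrightarrow> regularizer \<rho> \<tau> qs + inner ls (qs - grad us) + \<beta> / 2 * (norm (qs - grad us))\<^sup>2
        - inner ls (qs - grad us) - \<beta> / 2 * (norm (qs - grad us))\<^sup>2"
      unfolding g_def by (intro tendsto_intros l_m q_Suc lin_lim[OF linear_grad] u_m)
    then have "g \<longlonglongrightarrow> regularizer \<rho> \<tau> qs" by simp
    moreover have "regularizer \<rho> \<tau> (q (Suc (m k))) \<le> g k" for k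
      using q_min[of "m k" qs] by (simp add: g_def)
    ultimately have R: "(\<lambda>k. regularizer \<rho> \<tau> (q (Suc (m k)))) \<longlonglongrightarrow> regularizer \<rho> \<tau> qs"
      by (intro regularizer_squeeze[OF AS1 AS3 tau q_Suc, of g])
    show ?thesis
      unfolding limiting_subdiff_def mem_Collect_eq
    proof (intro conjI exI allI)
      show "(\<lambda>k. ereal (regularizer \<rho> \<tau> (q (Suc (m k))))) \<longlonglongrightarrow> ereal (regularizer \<rho> \<tau> qs)"
        using R by simp
      show "0 \<le> Liminf (at (q (Suc (m k)))) (\<lambda>v. (ereal (regularizer \<rho> \<tau> v)
          - ereal (regularizer \<rho> \<tau> (q (Suc (m k)))) - ereal (inner (w k) (v - q (Suc (m k)))))
          / ereal (norm (v - q (Suc (m k)))))" for k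
        unfolding w_def by (rule regular_subgradient_of_proximal_min[OF q_min])
    qed (use q_Suc w in simp_all)
  qed
  with stationary feasible show ?thesis
    by (simp add: KKT_point_def p)
qed

end
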